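(* Let $T>0$, $I=[-T,T]$, $m\in\mathbb{R}$, $\alpha=mT$, $h\in L^1(I)$ and $c\in\mathbb{R}$. Assume $\alpha\in(0,\pi/4)$, and let $F\in W^{1,1}(I)'\cap\mathcal{C}_c(I)'$, with associated Borel measure $\mu$, be such that $F(\cos mt)>F(\sin mt)$ (that is, the value of $F$ on $t\mapsto\cos mt$ is greater than its value on $t\mapsto\sin mt$). If $$c>\frac{2M\,|\mu|(I)\,\|h\|_1}{1-\tan\alpha},$$ then the solution $u$ of the problem $$x'(t)+m\,x(-t)=h(t)\ \text{ for a.e. } t\in I,\qquad F(x)=c,$$ is positive, i.e. $u(t)>0$ for all $t\in I$.
   Context: $W^{1,1}(I)$ is the Sobolev space of (absolutely continuous) functions $f:I\to\mathbb{R}$ with $f'\in L^1(I)$, and $W^{1,1}(I)'$ is its dual. $\mathcal{C}_c(I)$ is the space of compactly supported continuous functions on $I$ (since $I$ is compact, all continuous functions on $I$) with dual $\mathcal{C}_c(I)'$. For $F\in W^{1,1}(I)'\cap\mathcal{C}_c(I)'$, the associated Borel measure $\mu$ is the (possibly signed) regular Borel measure of bounded variation on $I$ given by the Riesz Representation Theorem, so that $F(x)=\int_{-T}^{T}x\,d\mu$; $|\mu|(I)$ is the total variation of $\mu$ on $I$. $\|h\|_1$ is the $L^1(I)$ norm of $h$. The solution of the problem is sought in $W^{1,1}(I)$; under the stated hypotheses it exists and is unique. The constant $M$ is $M:=\max_{t,s\in I}\overline{G}(t,s)$ (understood as the supremum over $t\neq s$, since $\overline{G}$ jumps across the diagonal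 $t=s$), where $\overline{G}$ is the Green's function of the periodic problem $x'(t)+m\,x(-t)=h(t)$, $t\in I$, $x(-T)=x(T)$. Explicitly, with $\alpha=mT$, $t=zT$, $s=yT$, $z,y\in[-1,1]$: $$\sin(\alpha)\,\overline{G}(t,s)=\begin{cases}\cos[\alpha(1-z)-\frac{\pi}{4}]\cos(\alpha y-\frac{\pi}{4}) & \text{if } z>|y|,\\ \cos(\alpha z+\frac{\pi}{4})\cos[\alpha(y-1)-\frac{\pi}{4}] & \text{if } |z|<y,\\ \cos(\alpha z+\frac{\pi}{4})\cos[\alpha(1+y)-\frac{\pi}{4}] & \text{if } -|z|>y,\\ \cos[\alpha(z+1)+\frac{\pi}{4}]\cos(\alpha y-\frac{\pi}{4}) & \text{if } z<-|y|,\end{cases}$$ extended continuously across the points with $z=-y\neq 0$. *)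

theory Defs
  imports "HOL-Analysis.Analysis"
begin

section \<open>Function spaces on a compact interval and their duals\<close>

text \<open>A function on \<open>{a..b}\<close> is represented by a total function on the reals, and only its values on
  \<open>{a..b}\<close> matter. Derivatives below are two-sided, which concerns interior points only; the
  endpoints form a null set.\<close>

text \<open>The usual epsilon-delta definition. A division consists of finitely many nonempty compact
  intervals \<open>k = {Inf k..Sup k}\<close> with disjoint interiors.\<close>

definition abs_cont_on :: "real \<Rightarrow> real \<Rightarrow> (real \<Rightarrow> real) \<Rightarrow> bool" where
  "abs_cont_on a b f \<longleftrightarrow>
     (\<forall>\<epsilon>>0. \<exists>\<delta>>0. \<forall>\<D>. \<D> division_of \<Union>\<D> \<and> \<Union>\<D> \<subseteq> {a..b} \<and> (\<Sum>k\<in>\<D>. Sup k - Inf k) < \<delta>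
        \<longrightarrow> (\<Sum>k\<in>\<D>. \<bar>f (Sup k) - f (Inf k)\<bar>) < \<epsilon>)"

definition L1_norm :: "real \<Rightarrow> real \<Rightarrow> (real \<Rightarrow> real) \<Rightarrow> real" where
  "L1_norm a b f = (LINT t:{a..b}|lebesgue. \<bar>f t\<bar>)"

text \<open>An absolutely continuous function is differentiable almost everywhere, so that \<open>deriv f\<close> is
  its derivative up to a null set.\<close>

definition W11 :: "real \<Rightarrow> real \<Rightarrow> (real \<Rightarrow> real) set" where
  "W11 a b = {f. abs_cont_on a b f \<and> set_integrable lebesgue {a..b} (deriv f)}"

definition W11_norm :: "real \<Rightarrow> real \<Rightarrow> (real \<Rightarrow> real) \<Rightarrow> real" where
  "W11_norm a b f = L1_norm a b f + L1_norm a b (deriv f)"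

definition cont_fun :: "real \<Rightarrow> real \<Rightarrow> (real \<Rightarrow> real) set" where
  "cont_fun a b = {f. continuous_on {a..b} f}"

definition sup_norm :: "real \<Rightarrow> real \<Rightarrow> (real \<Rightarrow> real) \<Rightarrow> real" where
  "sup_norm a b f = (SUP t\<in>{a..b}. \<bar>f t\<bar>)"

text \<open>Bounded linear functionals on the function space \<open>V\<close> with (semi)norm \<open>N\<close>. Boundedness
  forces \<open>F f = F g\<close> whenever \<open>N (f - g) = 0\<close>, in particular if \<open>f = g\<close> on the interval.\<close>

definition dual_space ::
    "(real \<Rightarrow> real) set \<Rightarrow> ((real \<Rightarrow> real) \<Rightarrow> real) \<Rightarrow> ((real \<Rightarrow> real) \<Rightarrow> real) set" where
  "dual_space V N = {F.
     (\<forall>f\<in>V. \<forall>g\<in>V. F (\<lambda>t. f t + g t) = F f + F g) \<and>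
     (\<forall>r. \<forall>f\<in>V. F (\<lambda>t. r * f t) = r * F f) \<and>
     (\<exists>C. \<forall>f\<in>V. \<bar>F f\<bar> \<le> C * N f)}"

section \<open>Signed measures of bounded variation\<close>

text \<open>A signed measure is a real set function on \<open>sets M\<close>; the measure space \<open>M\<close> only supplies the
  underlying set and sigma-algebra.\<close>

definition signed_measure :: "'a measure \<Rightarrow> ('a set \<Rightarrow> real) \<Rightarrow> bool" where
  "signed_measure M \<mu> \<longleftrightarrow> \<mu> {} = 0 \<and>
     (\<forall>A :: nat \<Rightarrow> 'a set. range A \<subseteq> sets M \<and> disjoint_family A
        \<longrightarrow> (\<lambda>i. \<mu> (A i)) sums \<mu> (\<Union>i. A i))"

definition variation_sums :: "'a measure \<Rightarrow> ('a set \<Rightarrow> real) \<Rightarrow> 'a set \<Rightarrow> real set" where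
  "variation_sums M \<mu> A =
     {(\<Sum>B\<in>P. \<bar>\<mu> B\<bar>) | P. finite P \<and> P \<subseteq> sets M \<and> disjoint P \<and> \<Union>P = A}"

definition total_variation :: "'a measure \<Rightarrow> ('a set \<Rightarrow> real) \<Rightarrow> 'a set \<Rightarrow> real" where
  "total_variation M \<mu> A = Sup (variation_sums M \<mu> A)"

definition bounded_variation :: "'a measure \<Rightarrow> ('a set \<Rightarrow> real) \<Rightarrow> bool" where
  "bounded_variation M \<mu> \<longleftrightarrow> bdd_above (variation_sums M \<mu> (space M))"

definition regular_signed ::
    "'a::topological_space measure \<Rightarrow> ('a set \<Rightarrow> real) \<Rightarrow> bool" where
  "regular_signed M \<mu> \<longleftrightarrow>
     (\<forall>A\<in>sets M. \<forall>\<epsilon>>0. \<exists>K U. compact K \<and> open U \<and> K \<subseteq> A \<and> A \<subseteq> U \<and>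
        total_variation M \<mu> (U \<inter> space M - K) < \<epsilon>)"

text \<open>The Jordan decomposition: the upper variation \<open>\<mu>\<^sup>+\<close> of \<open>\<mu>\<close> is the measure
  \<open>A \<mapsto> sup {\<mu> B | B \<subseteq> A}\<close>, and the lower variation \<open>\<mu>\<^sup>-\<close> is the upper variation of \<open>- \<mu>\<close>.\<close>

definition upper_variation :: "'a measure \<Rightarrow> ('a set \<Rightarrow> real) \<Rightarrow> 'a measure" where
  "upper_variation M \<mu> = measure_of (space M) (sets M)
     (\<lambda>A. ennreal (SUP B\<in>{B \<in> sets M. B \<subseteq> A}. \<mu> B))"

definition signed_integral :: "'a measure \<Rightarrow> ('a set \<Rightarrow> real) \<Rightarrow> ('a \<Rightarrow> real) \<Rightarrow> real" where
  "signed_integral M \<mu> f =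
     (\<integral>t. f t \<partial>upper_variation M \<mu>) - (\<integral>t. f t \<partial>upper_variation M (\<lambda>A. - \<mu> A))"

abbreviation borel_on :: "real \<Rightarrow> real \<Rightarrow> real measure" where
  "borel_on a b \<equiv> restrict_space borel {a..b}"

text \<open>\<open>\<mu>\<close> is the measure associated with \<open>F\<close> by the Riesz representation theorem.\<close>

definition riesz_measure ::
    "real \<Rightarrow> real \<Rightarrow> ((real \<Rightarrow> real) \<Rightarrow> real) \<Rightarrow> (real set \<Rightarrow> real) \<Rightarrow> bool" where
  "riesz_measure a b F \<mu> \<longleftrightarrow>
     signed_measure (borel_on a b) \<mu> \<and>
     bounded_variation (borel_on a b) \<mu> \<and>
     regular_signed (borel_on a b) \<mu> \<and>
     (\<forall>f\<in>cont_fun a b. F f = signed_integral (borel_on a b) \<mu> f)"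

section \<open>The differential equation with reflection\<close>

text \<open>Green's function of \<open>x'(t) + m x(-t) = h(t)\<close>, \<open>x(-T) = x(T)\<close>. The four regions are the open
  sectors cut out by the lines \<open>z = y\<close> and \<open>z = -y\<close>; the half-lines \<open>z = -y \<noteq> 0\<close>, where the two
  adjacent formulas agree, are assigned to the first and second sector. On the diagonal \<open>z = y\<close>
  the function jumps; the value there is never used.\<close>

definition green :: "real \<Rightarrow> real \<Rightarrow> real \<Rightarrow> real \<Rightarrow> real" where
  "green T m t s = (let \<alpha> = m * T; z = t / T; y = s / T in
     (if z > \<bar>y\<bar> \<or> (z = - y \<and> z > 0)
        then cos (\<alpha> * (1 - z) - pi / 4) * cos (\<alpha> * y - pi / 4)
      else if \<bar>z\<bar> < y \<or> (z = - y \<and> z < 0)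
        then cos (\<alpha> * z + pi / 4) * cos (\<alpha> * (y - 1) - pi / 4)
      else if - \<bar>z\<bar> > y
        then cos (\<alpha> * z + pi / 4) * cos (\<alpha> * (1 + y) - pi / 4)
      else if z < - \<bar>y\<bar>
        then cos (\<alpha> * (z + 1) + pi / 4) * cos (\<alpha> * y - pi / 4)
      else undefined) / sin \<alpha>)"

definition green_max :: "real \<Rightarrow> real \<Rightarrow> real" where
  "green_max T m = Sup {green T m t s | t s. t \<in> {-T..T} \<and> s \<in> {-T..T} \<and> t \<noteq> s}"

definition is_solution ::
    "real \<Rightarrow> real \<Rightarrow> (real \<Rightarrow> real) \<Rightarrow> ((real \<Rightarrow> real) \<Rightarrow> real) \<Rightarrow> real \<Rightarrow> (real \<Rightarrow> real) \<Rightarrow> bool" where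
  "is_solution T m h F c u \<longleftrightarrow>
     u \<in> W11 (-T) T \<and>
     (AE t in lebesgue. t \<in> {-T..T} \<longrightarrow>
        (\<exists>u'. (u has_real_derivative u') (at t) \<and> u' + m * u (- t) = h t)) \<and>
     F u = c"

end

theory Submission
  imports Defs
begin

text \<open>Subtracting a suitable multiple \<open>k (cos m t - sin m t)\<close> of the homogeneous solution from \<open>u\<close>
  leaves a solution \<open>H\<close> of the equation with \<open>H (-T) = H T\<close>. This periodic part is the integral of
  \<open>h\<close> against Green's function, hence bounded by \<open>M \<parallel>h\<parallel>\<^sub>1\<close>. Applying \<open>F\<close> gives
  \<open>k (F cos - F sin) = c - F H\<close> with \<open>\<bar>F H\<bar> \<le> M \<parallel>h\<parallel>\<^sub>1 \<bar>\<mu>\<bar>(I)\<close> and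
  \<open>F cos - F sin \<le> (cos \<alpha> + sin \<alpha>) \<bar>\<mu>\<bar>(I)\<close>. The bound on \<open>c\<close> says precisely that the resulting
  lower bound for \<open>k (cos \<alpha> - sin \<alpha>)\<close>, where \<open>cos \<alpha> - sin \<alpha>\<close> is the minimum of
  \<open>cos m t - sin m t\<close>, exceeds \<open>M \<parallel>h\<parallel>\<^sub>1\<close>.\<close>

section \<open>Absolutely continuous functions\<close>

lemma division_interval:
  fixes a b :: real
  assumes "\<D> division_of \<Union>\<D>" "\<Union>\<D> \<subseteq> {a..b}" "k \<in> \<D>"
  shows "k = {Inf k..Sup k}" "Inf k \<le> Sup k" "Inf k \<in> {a..b}" "Sup k \<in> {a..b}"
proof -
  obtain u v where uv: "k = {u..v}" "k \<noteq> {}"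
    using assms(1,3) by (metis division_ofD(3,4) interval_cbox)
  moreover have "k \<subseteq> {a..b}" using assms by blast
  ultimately show "k = {Inf k..Sup k}" "Inf k \<le> Sup k" "Inf k \<in> {a..b}" "Sup k \<in> {a..b}"
    by auto
qed

lemma abs_cont_onD:
  assumes "abs_cont_on a b f" "0 < \<epsilon>"
  obtains \<delta> where "0 < \<delta>"
    "\<And>\<D>. \<D> division_of \<Union>\<D> \<Longrightarrow> \<Union>\<D> \<subseteq> {a..b} \<Longrightarrow> (\<Sum>k\<in>\<D>. Sup k - Inf k) < \<delta>
      \<Longrightarrow> (\<Sum>k\<in>\<D>. \<bar>f (Sup k) - f (Inf k)\<bar>) < \<epsilon>"
  using assms unfolding abs_cont_on_def by meson

lemma abs_cont_onI:
  assumes "\<And>\<epsilon>. 0 < \<epsilon> \<Longrightarrow> \<exists>\<delta>>0. \<forall>\<D>. \<D> division_of \<Union>\<D> \<longrightarrow> \<Union>\<D> \<subseteq> {a..b} \<longrightarrow>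
      (\<Sum>k\<in>\<D>. Sup k - Inf k) < \<delta> \<longrightarrow> (\<Sum>k\<in>\<D>. \<bar>f (Sup k) - f (Inf k)\<bar>) < \<epsilon>"
  shows "abs_cont_on a b f"
  using assms unfolding abs_cont_on_def by (simp add: imp_conjL)

lemma abs_cont_on_subset:
  assumes "abs_cont_on a b f" "{c..d} \<subseteq> {a..b}"
  shows "abs_cont_on c d f"
  using assms unfolding abs_cont_on_def by (meson subset_trans)

text \<open>Divisions with a single interval already give uniform continuity.\<close>

lemma abs_cont_on_imp_continuous_on:
  assumes "abs_cont_on a b f"
  shows "continuous_on {a..b} f"
proof (rule uniformly_continuous_imp_continuous, unfold uniformly_continuous_on_def, intro allI impI)
  fix e :: real assume "0 < e"
  then obtain \<delta> where \<delta>: "0 < \<delta>"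
    "\<And>\<D>. \<D> division_of \<Union>\<D> \<Longrightarrow> \<Union>\<D> \<subseteq> {a..b} \<Longrightarrow> (\<Sum>k\<in>\<D>. Sup k - Inf k) < \<delta>
      \<Longrightarrow> (\<Sum>k\<in>\<D>. \<bar>f (Sup k) - f (Inf k)\<bar>) < e"
    using assms abs_cont_onD by blast
  have *: "\<bar>f y - f x\<bar> < e" if "x \<in> {a..b}" "y \<in> {a..b}" "x \<le> y" "y - x < \<delta>" for x y
  proof -
    have "{{x..y}} division_of \<Union>{{x..y}}"
      using division_of_self[of x y] that by (simp add: box_real)
    from \<delta>(2)[OF this] show ?thesis using that by auto
  qed
  show "\<exists>d>0. \<forall>x\<in>{a..b}. \<forall>x'\<in>{a..b}. dist x' x < d \<longrightarrow> dist (f x') (f x) < e"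
  proof (intro exI[of _ \<delta>] conjI ballI impI \<delta>(1))
    fix x x' assume "x \<in> {a..b}" "x' \<in> {a..b}" "dist x' x < \<delta>"
    then show "dist (f x') (f x) < e"
      using *[of x x'] *[of x' x] by (cases "x \<le> x'") (auto simp: dist_real_def)
  qed
qed

lemma lipschitz_imp_abs_cont_on:
  assumes "\<And>x y. x \<in> {a..b} \<Longrightarrow> y \<in> {a..b} \<Longrightarrow> \<bar>f y - f x\<bar> \<le> L * \<bar>y - x\<bar>"
  shows "abs_cont_on a b f"
proof (rule abs_cont_onI)
  fix e :: real assume "0 < e"
  define \<delta> where "\<delta> = e / (\<bar>L\<bar> + 1)"
  have "(\<Sum>k\<in>\<D>. \<bar>f (Sup k) - f (Inf k)\<bar>) < e"
    if D: "\<D> division_of \<Union>\<D>" "\<Union>\<D> \<subseteq> {a..b}" and small: "(\<Sum>k\<in>\<D>. Sup k - Inf k) < \<delta>" for \<D>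
  proof -
    have "(\<Sum>k\<in>\<D>. \<bar>f (Sup k) - f (Inf k)\<bar>) \<le> (\<Sum>k\<in>\<D>. (\<bar>L\<bar> + 1) * (Sup k - Inf k))"
    proof (rule sum_mono)
      fix k assume "k \<in> \<D>"
      note k = division_interval[OF D this]
      have "\<bar>f (Sup k) - f (Inf k)\<bar> \<le> L * \<bar>Sup k - Inf k\<bar>" using k assms by blast
      also have "\<dots> \<le> (\<bar>L\<bar> + 1) * (Sup k - Inf k)"
        using k(2) by (simp add: mult_right_mono)
      finally show "\<bar>f (Sup k) - f (Inf k)\<bar> \<le> (\<bar>L\<bar> + 1) * (Sup k - Inf k)" .
    qed
    also have "\<dots> = (\<bar>L\<bar> + 1) * (\<Sum>k\<in>\<D>. Sup k - Inf k)" by (simp add: sum_distrib_left)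
    also have "\<dots> < (\<bar>L\<bar> + 1) * \<delta>" using small by (intro mult_strict_left_mono) auto
    also have "\<dots> = e" by (simp add: \<delta>_def)
    finally show ?thesis .
  qed
  moreover have "0 < \<delta>" using \<open>0 < e\<close> by (simp add: \<delta>_def)
  ultimately show "\<exists>\<delta>>0. \<forall>\<D>. \<D> division_of \<Union>\<D> \<longrightarrow> \<Union>\<D> \<subseteq> {a..b} \<longrightarrow>
      (\<Sum>k\<in>\<D>. Sup k - Inf k) < \<delta> \<longrightarrow> (\<Sum>k\<in>\<D>. \<bar>f (Sup k) - f (Inf k)\<bar>) < e"
    by blast
qed

text \<open>A common criterion for sums and products, whose increments are dominated by those of the
  two constituents; \<open>f\<close> and \<open>g\<close> each receive the share
  \<open>e / (2 * A)\<close> of the error.\<close>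

lemma abs_cont_on_increment_le:
  assumes f: "abs_cont_on a b f" and g: "abs_cont_on a b g" and "0 < A"
    and bd: "\<And>x y. x \<in> {a..b} \<Longrightarrow> y \<in> {a..b} \<Longrightarrow>
      \<bar>p y - p x\<bar> \<le> A * (\<bar>f y - f x\<bar> + \<bar>g y - g x\<bar>)"
  shows "abs_cont_on a b p"
proof (rule abs_cont_onI)
  fix e :: real assume "0 < e"
  then have "0 < e / (2 * A)" using \<open>0 < A\<close> by simp
  from abs_cont_onD[OF f this] obtain d1 where d1: "0 < d1"
    "\<And>\<D>. \<D> division_of \<Union>\<D> \<Longrightarrow> \<Union>\<D> \<subseteq> {a..b} \<Longrightarrow> (\<Sum>k\<in>\<D>. Sup k - Inf k) < d1
      \<Longrightarrow> (\<Sum>k\<in>\<D>. \<bar>f (Sup k) - f (Inf k)\<bar>) < e / (2 * A)"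
    by blast
  from abs_cont_onD[OF g \<open>0 < e / (2 * A)\<close>] obtain d2 where d2: "0 < d2"
    "\<And>\<D>. \<D> division_of \<Union>\<D> \<Longrightarrow> \<Union>\<D> \<subseteq> {a..b} \<Longrightarrow> (\<Sum>k\<in>\<D>. Sup k - Inf k) < d2
      \<Longrightarrow> (\<Sum>k\<in>\<D>. \<bar>g (Sup k) - g (Inf k)\<bar>) < e / (2 * A)"
    by blast
  have "(\<Sum>k\<in>\<D>. \<bar>p (Sup k) - p (Inf k)\<bar>) < e"
    if D: "\<D> division_of \<Union>\<D>" "\<Union>\<D> \<subseteq> {a..b}" and small: "(\<Sum>k\<in>\<D>. Sup k - Inf k) < min d1 d2" for \<D>
  proof -
    have "(\<Sum>k\<in>\<D>. \<bar>p (Sup k) - p (Inf k)\<bar>)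
        \<le> (\<Sum>k\<in>\<D>. A * (\<bar>f (Sup k) - f (Inf k)\<bar> + \<bar>g (Sup k) - g (Inf k)\<bar>))"
      by (intro sum_mono bd division_interval(3,4)[OF D])
    also have "\<dots> = A * ((\<Sum>k\<in>\<D>. \<bar>f (Sup k) - f (Inf k)\<bar>) + (\<Sum>k\<in>\<D>. \<bar>g (Sup k) - g (Inf k)\<bar>))"
      by (simp flip: sum_distrib_left sum.distrib)
    also have "\<dots> < A * (e / (2 * A) + e / (2 * A))"
      using d1(2)[OF D] d2(2)[OF D] small \<open>0 < A\<close> by (intro mult_strict_left_mono add_strict_mono) auto
    also have "\<dots> = e" using \<open>0 < A\<close> by (simp add: field_simps)
    finally show ?thesis .
  qed
  then show "\<exists>\<delta>>0. \<forall>\<D>. \<D> division_of \<Union>\<D> \<longrightarrow> \<Union>\<D> \<subseteq> {a..b} \<longrightarrow>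
      (\<Sum>k\<in>\<D>. Sup k - Inf k) < \<delta> \<longrightarrow> (\<Sum>k\<in>\<D>. \<bar>p (Sup k) - p (Inf k)\<bar>) < e"
    using d1(1) d2(1) by (intro exI[of _ "min d1 d2"]) auto
qed

lemma abs_cont_on_add:
  assumes "abs_cont_on a b f" "abs_cont_on a b g"
  shows "abs_cont_on a b (\<lambda>x. f x + g x)"
  by (rule abs_cont_on_increment_le[OF assms zero_less_one]) auto

lemma abs_cont_on_mult:
  assumes f: "abs_cont_on a b f" and g: "abs_cont_on a b g"
  shows "abs_cont_on a b (\<lambda>x. f x * g x)"
proof -
  have "\<exists>C. \<forall>x\<in>{a..b}. \<bar>q x\<bar> \<le> C" if "abs_cont_on a b q" for q
  proof -
    have "bounded (q ` {a..b})"
      using that by (intro compact_imp_bounded compact_continuous_image abs_cont_on_imp_continuous_on compact_Icc)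
    then show ?thesis by (auto simp: bounded_iff)
  qed
  then obtain B C where B: "\<forall>x\<in>{a..b}. \<bar>f x\<bar> \<le> B" and C: "\<forall>x\<in>{a..b}. \<bar>g x\<bar> \<le> C"
    using f g by meson
  define A where "A = \<bar>B\<bar> + \<bar>C\<bar> + 1"
  show ?thesis
  proof (rule abs_cont_on_increment_le[OF f g, of A])
    fix x y assume xy: "x \<in> {a..b}" "y \<in> {a..b}"
    have "\<bar>f y * g y - f x * g x\<bar> = \<bar>(f y - f x) * g y + f x * (g y - g x)\<bar>"
      by (simp add: algebra_simps)
    also have "\<dots> \<le> \<bar>f y - f x\<bar> * \<bar>g y\<bar> + \<bar>f x\<bar> * \<bar>g y - g x\<bar>"
      by (metis abs_mult abs_triangle_ineq)
    also have "\<dots> \<le> \<bar>f y - f x\<bar> * A + A * \<bar>g y - g x\<bar>"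
      using B C xy unfolding A_def by (intro add_mono mult_left_mono mult_right_mono) force+
    finally show "\<bar>f y * g y - f x * g x\<bar> \<le> A * (\<bar>f y - f x\<bar> + \<bar>g y - g x\<bar>)"
      by (simp add: algebra_simps)
  qed (simp add: A_def)
qed

text \<open>Negation carries a division to a division of the same total length; only the roles of
  \<open>Inf k\<close> and \<open>Sup k\<close> are exchanged.\<close>

lemma abs_cont_on_reflect:
  assumes "abs_cont_on a b f"
  shows "abs_cont_on (- b) (- a) (\<lambda>x. f (- x))"
proof (rule abs_cont_onI)
  fix e :: real assume "0 < e"
  then obtain \<delta> where \<delta>: "0 < \<delta>"
    "\<And>\<D>. \<D> division_of \<Union>\<D> \<Longrightarrow> \<Union>\<D> \<subseteq> {a..b} \<Longrightarrow> (\<Sum>k\<in>\<D>. Sup k - Inf k) < \<delta>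
      \<Longrightarrow> (\<Sum>k\<in>\<D>. \<bar>f (Sup k) - f (Inf k)\<bar>) < e"
    using assms abs_cont_onD by blast
  have "(\<Sum>k\<in>\<D>. \<bar>f (- Sup k) - f (- Inf k)\<bar>) < e"
    if D: "\<D> division_of \<Union>\<D>" "\<Union>\<D> \<subseteq> {-b..-a}" and small: "(\<Sum>k\<in>\<D>. Sup k - Inf k) < \<delta>" for \<D>
  proof -
    define R :: "real set \<Rightarrow> real set" where "R = (`) uminus"
    have inj: "inj_on R \<D>" by (auto simp: R_def inj_on_def inj_image_eq_iff)
    have R: "R k = {- Sup k..- Inf k}" if "k \<in> \<D>" for k
    proof -
      have "R k = uminus ` {Inf k..Sup k}" using division_interval(1)[OF D that] R_def by simp
      then show ?thesis by simp
    qed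
    have ends: "Sup (R k) = - Inf k" "Inf (R k) = - Sup k" if "k \<in> \<D>" for k
      using division_interval(2)[OF D that] unfolding R[OF that] by auto
    have "R ` \<D> division_of \<Union>(R ` \<D>)"
    proof (rule division_ofI)
      show "finite (R ` \<D>)" using D(1) by blast
      fix K assume "K \<in> R ` \<D>"
      then obtain k where k: "k \<in> \<D>" "K = R k" by blast
      show "K \<noteq> {}" using division_interval(2)[OF D k(1)] R k by auto
      show "\<exists>a b. K = cbox a b" using R k by auto
      show "K \<subseteq> \<Union>(R ` \<D>)" using k by auto
      fix L assume "L \<in> R ` \<D>" "K \<noteq> L"
      then obtain l where l: "l \<in> \<D>" "L = R l" by blast
      with \<open>K \<noteq> L\<close> k have "interior k \<inter> interior l = {}"
        using division_ofD(5)[OF D(1)] by metis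
      moreover have "interior (R j) = uminus ` interior j" for j
        unfolding R_def by (rule interior_negations)
      ultimately show "interior K \<inter> interior L = {}" using k l by auto
    qed auto
    moreover have "\<Union>(R ` \<D>) \<subseteq> {a..b}"
      using D(2) by (fastforce simp: R_def)
    moreover have "(\<Sum>k\<in>R ` \<D>. Sup k - Inf k) < \<delta>"
      using small ends by (simp add: sum.reindex[OF inj])
    ultimately have "(\<Sum>k\<in>R ` \<D>. \<bar>f (Sup k) - f (Inf k)\<bar>) < e" by (rule \<delta>(2))
    then show ?thesis using ends by (simp add: sum.reindex[OF inj] abs_minus_commute)
  qed
  then show "\<exists>\<delta>>0. \<forall>\<D>. \<D> division_of \<Union>\<D> \<longrightarrow> \<Union>\<D> \<subseteq> {-b..-a} \<longrightarrow>
      (\<Sum>k\<in>\<D>. Sup k - Inf k) < \<delta> \<longrightarrow> (\<Sum>k\<in>\<D>. \<bar>f (- Sup k) - f (- Inf k)\<bar>) < e"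
    using \<delta>(1) by blast
qed

section \<open>The fundamental theorem of calculus for absolutely continuous functions\<close>

lemma straddle_interval:
  fixes f :: "real \<Rightarrow> real"
  assumes d: "\<And>y. y \<in> {u..v} \<Longrightarrow> \<bar>f y - f x - D * (y - x)\<bar> \<le> e * \<bar>y - x\<bar>" and x: "x \<in> {u..v}"
  shows "\<bar>(v - u) * D - (f v - f u)\<bar> \<le> e * (v - u)"
proof -
  \<comment> \<open>Both errors are measured from the tag \<open>x\<close>; as \<open>x\<close> lies
    between \<open>u\<close> and \<open>v\<close>, the two distances add up to
    \<open>v - u\<close>.\<close>
  have "\<bar>f v - f x - D * (v - x)\<bar> \<le> e * (v - x)" "\<bar>f u - f x - D * (u - x)\<bar> \<le> e * (x - u)"
    using d[of u] d[of v] x by auto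
  then show ?thesis by (auto simp: abs_le_iff algebra_simps)
qed

text \<open>Intervals of a fine tagged division with tags in the exceptional null set lie in an open set
  of small measure, so that absolute continuity controls their contribution.\<close>

theorem fundamental_theorem_of_calculus_abs_cont:
  assumes "a \<le> b" and ac: "abs_cont_on a b f" and N: "negligible N"
    and der: "\<And>x. x \<in> {a..b} - N \<Longrightarrow> (f has_real_derivative g x) (at x)"
  shows "(g has_integral (f b - f a)) {a..b}"
proof (cases "a = b")
  case False
  with \<open>a \<le> b\<close> have "a < b" by simp
  \<comment> \<open>With the value 0 on \<open>N\<close>, a term of the Riemann sum tagged in
    \<open>N\<close> leaves only the increment of \<open>f\<close> to be estimated.\<close>
  define g' where "g' x = (if x \<in> N then 0 else g x)" for x
  have "(g' has_integral (f b - f a)) {a..b}"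
    unfolding has_integral_factor_content_real
  proof (intro allI impI)
    fix e :: real assume "0 < e"
    \<comment> \<open>Half of the admissible error \<open>e * (b - a)\<close> is reserved for tags
      in \<open>N\<close>; the other half is the differentiability error, \<open>e / 2\<close> per
      unit length.\<close>
    define \<epsilon> where "\<epsilon> = e / 2 * (b - a)"
    have "0 < \<epsilon>" using \<open>0 < e\<close> \<open>a < b\<close> by (simp add: \<epsilon>_def)
    with ac obtain \<delta> where \<delta>: "0 < \<delta>"
      "\<And>\<D>. \<D> division_of \<Union>\<D> \<Longrightarrow> \<Union>\<D> \<subseteq> {a..b} \<Longrightarrow> (\<Sum>k\<in>\<D>. Sup k - Inf k) < \<delta>
        \<Longrightarrow> (\<Sum>k\<in>\<D>. \<bar>f (Sup k) - f (Inf k)\<bar>) < \<epsilon>"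
      using abs_cont_onD by blast
    obtain U where U: "open U" "N \<subseteq> U" and UN: "U - N \<in> lmeasurable"
        "emeasure lebesgue (U - N) < ennreal \<delta>"
      using sets_lebesgue_outer_open[OF negligible_imp_sets[OF N] \<delta>(1)] by blast
    have U_eq: "U = (U - N) \<union> N" using U(2) by blast
    have U_lm: "U \<in> lmeasurable"
      by (subst U_eq) (intro fmeasurable.Un UN(1) negligible_imp_measurable[OF N])
    have "measure lebesgue U \<le> measure lebesgue (U - N) + measure lebesgue N"
      by (subst U_eq) (intro measure_Un_le fmeasurableD UN(1) negligible_imp_sets[OF N])
    also have "\<dots> < \<delta>"
      using UN \<delta>(1) negligible_imp_measure0[OF N]
      by (simp add: emeasure_eq_measure2 ennreal_less_iff)
    finally have U_small: "measure lebesgue U < \<delta>" .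
    have "\<forall>x. \<exists>d>0. x \<in> {a..b} - N \<longrightarrow>
         (\<forall>y. \<bar>y - x\<bar> < d \<longrightarrow> \<bar>f y - f x - g x * (y - x)\<bar> \<le> e / 2 * \<bar>y - x\<bar>)"
    proof
      fix x
      show "\<exists>d>0. x \<in> {a..b} - N \<longrightarrow>
         (\<forall>y. \<bar>y - x\<bar> < d \<longrightarrow> \<bar>f y - f x - g x * (y - x)\<bar> \<le> e / 2 * \<bar>y - x\<bar>)"
      proof (cases "x \<in> {a..b} - N")
        case True
        with der \<open>0 < e\<close> show ?thesis
          unfolding has_field_derivative_def has_derivative_at_alt
          by (metis half_gt_zero real_norm_def)
      qed (use zero_less_one in blast)
    qed
    then obtain d where d0: "\<And>x. 0 < d x" and d: "\<And>x y. \<lbrakk>x \<in> {a..b} - N; \<bar>y - x\<bar> < d x\<rbrakk>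
        \<Longrightarrow> \<bar>f y - f x - g x * (y - x)\<bar> \<le> e / 2 * \<bar>y - x\<bar>"
      by metis
    define \<gamma> where "\<gamma> x = (if x \<in> N then U else ball x (d x))" for x
    have "norm ((\<Sum>(x, k)\<in>p. measure lborel k *\<^sub>R g' x) - (f b - f a)) \<le> e * measure lborel {a..b}"
      if p: "p tagged_division_of {a..b}" and fine: "\<gamma> fine p" for p
    proof -
      define q where "q = {xk \<in> p. fst xk \<in> N}"
      have "finite p" using p by blast
      have tel: "(\<Sum>(x, K)\<in>p. f (Sup K) - f (Inf K)) = f b - f a" "(\<Sum>(x, K)\<in>p. Sup K - Inf K) = b - a"
        using additive_tagged_division_1[OF \<open>a \<le> b\<close> p] additive_tagged_division_1[OF \<open>a \<le> b\<close> p, of "\<lambda>x. x"]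
        by auto
      have qpart: "q tagged_partial_division_of {a..b}"
        using p tagged_partial_division_subset[of p "{a..b}" q]
        by (auto simp: q_def tagged_division_of_def)
      define \<D> where "\<D> = snd ` q"
      have D: "\<D> division_of \<Union>\<D>"
        unfolding \<D>_def by (rule partial_division_of_tagged_division[OF qpart])
      have DI: "\<Union>\<D> \<subseteq> {a..b}"
        using tagged_partial_division_ofD(3)[OF qpart] unfolding \<D>_def by force
      have "\<Union>\<D> \<subseteq> U"
        using fine by (force simp: \<D>_def q_def fine_def \<gamma>_def)
      have "(\<Sum>k\<in>\<D>. Sup k - Inf k) = (\<Sum>k\<in>\<D>. measure lebesgue k)"
      proof (rule sum.cong)
        fix k assume "k \<in> \<D>"
        note k = division_interval(1,2)[OF D DI this]
        have "measure lebesgue {Inf k..Sup k} = Sup k - Inf k" using k(2) by simp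
        then show "Sup k - Inf k = measure lebesgue k" using k(1) by simp
      qed simp
      also have "\<dots> \<le> measure lebesgue U"
        using content_division[OF D] measure_mono_fmeasurable[OF \<open>\<Union>\<D> \<subseteq> U\<close> _ U_lm] lmeasurable_division[OF D]
        by (simp add: fmeasurableD)
      finally have "(\<Sum>k\<in>\<D>. \<bar>f (Sup k) - f (Inf k)\<bar>) < \<epsilon>"
        using U_small by (intro \<delta>(2)[OF D DI]) auto
      moreover have "(\<Sum>(x, K)\<in>q. \<bar>f (Sup K) - f (Inf K)\<bar>) = (\<Sum>k\<in>\<D>. \<bar>f (Sup k) - f (Inf k)\<bar>)"
      proof -
        \<comment> \<open>Passing from tagged pairs to intervals merges pairs that share a
          degenerate interval, so the summand must vanish on every interval with empty interior.
          \<open>?h\<close> ensures this on the empty set, where \<open>Sup\<close> and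
          \<open>Inf\<close> are unspecified.\<close>
        let ?h = "\<lambda>k. if k = {} then 0 else \<bar>f (Sup k) - f (Inf k)\<bar>"
        have ne: "k \<noteq> {}" if "k \<in> \<D>" for k
          using division_interval(1,2)[OF D DI that] by auto
        have "(\<Sum>(x, K)\<in>q. ?h K) = (\<Sum>k\<in>\<D>. ?h k)"
          unfolding \<D>_def
          by (rule sum.over_tagged_division_lemma[OF tagged_partial_division_of_Union_self[OF qpart]])
            (auto simp: not_less)
        moreover have "(\<Sum>(x, K)\<in>q. ?h K) = (\<Sum>(x, K)\<in>q. \<bar>f (Sup K) - f (Inf K)\<bar>)"
          using ne by (intro sum.cong) (force simp: \<D>_def)+
        moreover have "(\<Sum>k\<in>\<D>. ?h k) = (\<Sum>k\<in>\<D>. \<bar>f (Sup k) - f (Inf k)\<bar>)"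
          using ne by (intro sum.cong) auto
        ultimately show ?thesis by simp
      qed
      ultimately have small: "(\<Sum>(x, K)\<in>q. \<bar>f (Sup K) - f (Inf K)\<bar>) < \<epsilon>" by simp
      \<comment> \<open>Telescoping spreads \<open>f b - f a\<close> over the intervals of
        \<open>p\<close>, so that the error can be estimated interval by interval.\<close>
      have "norm ((\<Sum>(x, k)\<in>p. measure lborel k *\<^sub>R g' x) - (f b - f a))
        = norm (\<Sum>(x, K)\<in>p. measure lborel K *\<^sub>R g' x - (f (Sup K) - f (Inf K)))"
        by (simp add: tel(1)[symmetric] split_def sum_subtractf)
      also have "\<dots> \<le> (\<Sum>(x, K)\<in>p. e / 2 * (Sup K - Inf K) +
          (if x \<in> N then \<bar>f (Sup K) - f (Inf K)\<bar> else 0))"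
      proof (rule sum_norm_le, safe)
        fix x K assume xK: "(x, K) \<in> p"
        then obtain u v where K: "K = {u..v}" and "x \<in> {u..v}" and "x \<in> {a..b}"
          using p by (metis box_real(2) tagged_division_ofD(2,3,4) subsetD)
        then have [simp]: "Sup K = v" "Inf K = u" "measure lborel K = v - u" and "u \<le> v" by auto
        show "norm (measure lborel K *\<^sub>R g' x - (f (Sup K) - f (Inf K))) \<le> e / 2 * (Sup K - Inf K) +
          (if x \<in> N then \<bar>f (Sup K) - f (Inf K)\<bar> else 0)"
        proof (cases "x \<in> N")
          case True
          then show ?thesis using \<open>0 < e\<close> \<open>u \<le> v\<close> by (simp add: g'_def abs_minus_commute)
        next
          case False
          then have "K \<subseteq> ball x (d x)" using fineD[OF fine xK] by (simp add: \<gamma>_def)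
          then have "\<bar>(v - u) * g x - (f v - f u)\<bar> \<le> e / 2 * (v - u)"
            using False \<open>x \<in> {a..b}\<close> K \<open>x \<in> {u..v}\<close>
            by (intro straddle_interval[where x = x] d) (auto simp: dist_real_def)
          then show ?thesis using False by (simp add: g'_def)
        qed
      qed
      also have "\<dots> = e / 2 * (b - a) + (\<Sum>(x, K)\<in>p. if x \<in> N then \<bar>f (Sup K) - f (Inf K)\<bar> else 0)"
        by (simp add: tel(2)[symmetric] split_def sum.distrib sum_distrib_left)
      also have "(\<Sum>(x, K)\<in>p. if x \<in> N then \<bar>f (Sup K) - f (Inf K)\<bar> else 0)
          = (\<Sum>(x, K)\<in>q. \<bar>f (Sup K) - f (Inf K)\<bar>)"
        unfolding q_def split_def using \<open>finite p\<close> by (simp add: sum.inter_filter)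
      also have "e / 2 * (b - a) + \<dots> \<le> e * measure lborel {a..b}"
        using small \<open>a < b\<close> by (simp add: \<epsilon>_def field_simps)
      finally show ?thesis .
    qed
    moreover have "gauge \<gamma>"
      using U d0 by (auto simp: gauge_def \<gamma>_def)
    ultimately show "\<exists>d. gauge d \<and> (\<forall>p. p tagged_division_of {a..b} \<and> d fine p \<longrightarrow>
      norm ((\<Sum>(x, k)\<in>p. measure lborel k *\<^sub>R g' x) - (f b - f a)) \<le> e * measure lborel {a..b})"
      by blast
  qed
  then show ?thesis
    by (rule has_integral_spike[OF N, rotated]) (auto simp: g'_def)
qed (auto intro: has_integral_refl)

section \<open>The periodic problem with reflection\<close>

lemma abs_cont_on_const: "abs_cont_on a b (\<lambda>_. r)"
  by (rule lipschitz_imp_abs_cont_on[where L = 0]) simp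

text \<open>The free phase serves the rotated kernels and, with \<open>\<phi> = pi / 2\<close>, also
  the sine.\<close>

lemma abs_cont_on_cos: "abs_cont_on a b (\<lambda>t. cos (m * t + \<phi>))"
proof (rule lipschitz_imp_abs_cont_on)
  fix s t :: real
  have "norm (cos (m * t + \<phi>) - cos (m * s + \<phi>)) \<le> 1 * norm ((m * t + \<phi>) - (m * s + \<phi>))"
    by (rule field_differentiable_bound[of UNIV cos "\<lambda>x. - sin x"])
      (auto intro!: derivative_eq_intros simp: convex_UNIV)
  also have "(m * t + \<phi>) - (m * s + \<phi>) = m * (t - s)" by (simp add: algebra_simps)
  finally show "\<bar>cos (m * t + \<phi>) - cos (m * s + \<phi>)\<bar> \<le> \<bar>m\<bar> * \<bar>t - s\<bar>" by (simp add: abs_mult)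
qed

text \<open>The pair \<open>(x s, x (- s))\<close> solves a first-order linear system whose homogeneous part is a
  rotation; the two components of the rotated pair are absolutely continuous primitives of known
  functions.\<close>

lemma reflection_rotation_integral:
  fixes x h :: "real \<Rightarrow> real"
  assumes ac: "abs_cont_on (-T) T x" and N: "negligible N"
    and der: "\<And>t. t \<in> {-T..T} - N \<Longrightarrow> (x has_real_derivative h t - m * x (- t)) (at t)"
    and pq: "-T \<le> p" "p \<le> q" "q \<le> T"
  shows "((\<lambda>s. cos (m * s + \<psi> - pi / 4) * h s + cos (m * s + \<psi> + pi / 4) * h (- s)) has_integral
      (cos (m * q + \<psi> - pi / 4) * x q - cos (m * q + \<psi> + pi / 4) * x (- q)) -
      (cos (m * p + \<psi> - pi / 4) * x p - cos (m * p + \<psi> + pi / 4) * x (- p))) {p..q}"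
proof -
  define P where
    "P s = cos (m * s + (\<psi> - pi / 4)) * x s + - 1 * cos (m * s + (\<psi> + pi / 4)) * x (- s)" for s
  have ac_ref: "abs_cont_on (-T) T (\<lambda>s. x (- s))"
    using abs_cont_on_reflect[OF ac] by simp
  have "abs_cont_on (-T) T P"
    unfolding P_def by (intro abs_cont_on_add abs_cont_on_mult abs_cont_on_const abs_cont_on_cos ac ac_ref)
  then have acP: "abs_cont_on p q P"
    by (rule abs_cont_on_subset) (use pq in auto)
  \<comment> \<open>Differentiating \<open>P\<close> at \<open>s\<close> uses the equation at both
    \<open>s\<close> and \<open>- s\<close>, so the reflected exceptional set is removed as
    well.\<close>
  have "negligible (uminus ` N)"
    by (rule negligible_differentiable_image_negligible[OF _ N])
      (auto intro!: derivative_intros)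
  then have neg: "negligible (N \<union> uminus ` N)" using N by auto
  have dP: "(P has_real_derivative
      cos (m * s + \<psi> - pi / 4) * h s + cos (m * s + \<psi> + pi / 4) * h (- s)) (at s)"
    if s: "s \<in> {p..q} - (N \<union> uminus ` N)" for s
  proof -
    have "s \<in> {-T..T} - N" "- s \<in> {-T..T} - N"
      using s pq by (auto simp: image_iff)
    note d1 = der[OF this(1)] and d2 = der[OF this(2)]
    have d3: "((\<lambda>s. x (- s)) has_real_derivative - (h (- s) - m * x s)) (at s)"
      using d2 by (simp add: DERIV_mirror)
    have dc: "((\<lambda>s. cos (m * s + \<phi>)) has_real_derivative - (m * sin (m * s + \<phi>))) (at s)" for \<phi>
      by (auto intro!: derivative_eq_intros)
    \<comment> \<open>These quarter-turn identities make each kernel the derivative of the other up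
      to a factor \<open>m\<close> or \<open>- m\<close>; all terms with \<open>x s\<close> or
      \<open>x (- s)\<close> in the derivative of \<open>P\<close> then cancel.\<close>
    have sc: "sin (m * s + (\<psi> - pi / 4)) = - cos (m * s + \<psi> + pi / 4)"
      "sin (m * s + (\<psi> + pi / 4)) = cos (m * s + \<psi> - pi / 4)"
      using minus_sin_cos_eq[of "m * s + \<psi> - pi / 4"] sin_cos_eq[of "m * s + \<psi> + pi / 4"]
        cos_minus[of "m * s + \<psi> - pi / 4"]
      by (simp_all add: algebra_simps)
    have cc: "cos (m * s + (\<psi> - pi / 4)) = cos (m * s + \<psi> - pi / 4)"
      "cos (m * s + (\<psi> + pi / 4)) = cos (m * s + \<psi> + pi / 4)"
      by (simp_all add: add.assoc add_diff_eq)
    define c1 c2 where "c1 = cos (m * s + \<psi> - pi / 4)" and "c2 = cos (m * s + \<psi> + pi / 4)"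
    note dP = DERIV_add[OF DERIV_mult[OF dc d1] DERIV_mult[OF DERIV_cmult[OF dc] d3]]
    show ?thesis
      unfolding P_def
      by (rule DERIV_cong[OF dP], unfold sc cc, fold c1_def c2_def) (simp add: algebra_simps)
  qed
  have "((\<lambda>s. cos (m * s + \<psi> - pi / 4) * h s + cos (m * s + \<psi> + pi / 4) * h (- s)) has_integral
      (P q - P p)) {p..q}"
    by (rule fundamental_theorem_of_calculus_abs_cont[OF pq(2) acP neg dP])
  then show ?thesis by (simp add: P_def add.assoc add_diff_eq)
qed

section \<open>Estimating periodic solutions by Green's function\<close>

lemma scaled_integral_bound:
  fixes h :: "real \<Rightarrow> real"
  assumes int: "((\<lambda>s. a s * h s + b s * h (- s)) has_integral A) {p..q}"
    and h: "(\<lambda>s. \<bar>h s\<bar> + \<bar>h (- s)\<bar>) integrable_on {p..q}"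
    and a: "\<And>s. p < s \<Longrightarrow> s < q \<Longrightarrow> \<bar>K * a s\<bar> \<le> C"
    and b: "\<And>s. p < s \<Longrightarrow> s < q \<Longrightarrow> \<bar>K * b s\<bar> \<le> C"
  shows "\<bar>K * A\<bar> \<le> C * integral {p..q} (\<lambda>s. \<bar>h s\<bar> + \<bar>h (- s)\<bar>)"
proof -
  let ?f = "\<lambda>s. K * (a s * h s + b s * h (- s))" and ?g = "\<lambda>s. C * (\<bar>h s\<bar> + \<bar>h (- s)\<bar>)"
  have f: "(?f has_integral K * A) {p..q}" by (rule has_integral_mult_right[OF int])
  \<comment> \<open>The open interval changes no integral and demands the kernel bounds only for
    interior \<open>s\<close>, which in the application stays off the diagonal where Green's
    function jumps.\<close>
  have "norm (integral {p<..<q} ?f) \<le> integral {p<..<q} ?g"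
  proof (rule integral_norm_bound_integral)
    show "?f integrable_on {p<..<q}" "?g integrable_on {p<..<q}"
      using has_integral_integrable[OF f] integrable_on_cmult_left[OF h, of C]
      by (simp_all add: integrable_on_open_interval_real)
    fix s assume "s \<in> {p<..<q}"
    then have "\<bar>K * a s * h s + K * b s * h (- s)\<bar> \<le> C * \<bar>h s\<bar> + C * \<bar>h (- s)\<bar>"
      using a[of s] b[of s]
      by (intro order_trans[OF abs_triangle_ineq] add_mono) (simp_all add: abs_mult[of "_ * _"] mult_right_mono)
    then show "norm (?f s) \<le> ?g s" by (simp add: algebra_simps)
  qed
  then show ?thesis
    unfolding integral_open_interval_real[symmetric] integral_unique[OF f] by simp
qed

text \<open>Eliminating the scaled variables \<open>z\<close> and \<open>y\<close> on the open
  sectors makes the four products comparable with the kernels of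
  \<open>reflection_rotation_integral\<close>.\<close>

lemma green_sectors:
  assumes "0 < T"
  shows "\<bar>s\<bar> < t \<Longrightarrow> green T m t s = cos (m * (t - T) + pi / 4) * cos (m * s - pi / 4) / sin (m * T)"
    and "\<bar>t\<bar> < s \<Longrightarrow> green T m t s = cos (m * t + pi / 4) * cos (m * (s - T) - pi / 4) / sin (m * T)"
    and "s < - \<bar>t\<bar> \<Longrightarrow> green T m t s = cos (m * t + pi / 4) * cos (m * (T + s) - pi / 4) / sin (m * T)"
    and "t < - \<bar>s\<bar> \<Longrightarrow> green T m t s = cos (m * (t + T) + pi / 4) * cos (m * s - pi / 4) / sin (m * T)"
proof -
  define z y where "z = t / T" and "y = s / T"
  have less: "\<bar>s\<bar> < t \<longleftrightarrow> \<bar>y\<bar> < z" "\<bar>t\<bar> < s \<longleftrightarrow> \<bar>z\<bar> < y" "s < - \<bar>t\<bar> \<longleftrightarrow> y < - \<bar>z\<bar>" "t < - \<bar>s\<bar> \<longleftrightarrow> z < - \<bar>y\<bar>"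
    using assms by (simp_all add: z_def y_def abs_if field_simps)
  \<comment> \<open>In the first sector the evenness of the cosine reverses the sign of
    \<open>1 - z\<close>.\<close>
  have "cos (m * T * (1 - z) - pi / 4) = cos (- (m * (t - T) + pi / 4))"
    using assms by (intro arg_cong[where f = cos]) (simp add: z_def field_simps)
  then have args: "cos (m * T * (1 - z) - pi / 4) = cos (m * (t - T) + pi / 4)"
      "m * T * y = m * s" "m * T * z = m * t" "m * T * (y - 1) = m * (s - T)"
      "m * T * (1 + y) = m * (T + s)" "m * T * (z + 1) = m * (t + T)"
    using assms unfolding cos_minus by (simp_all add: z_def y_def field_simps)
  note defs = green_def Let_def z_def[symmetric] y_def[symmetric] less args
  show "\<bar>s\<bar> < t \<Longrightarrow> green T m t s = cos (m * (t - T) + pi / 4) * cos (m * s - pi / 4) / sin (m * T)"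
    unfolding defs by (subst if_P) auto
  show "\<bar>t\<bar> < s \<Longrightarrow> green T m t s = cos (m * t + pi / 4) * cos (m * (s - T) - pi / 4) / sin (m * T)"
    unfolding defs by (subst if_not_P, force, subst if_P) auto
  show "s < - \<bar>t\<bar> \<Longrightarrow> green T m t s = cos (m * t + pi / 4) * cos (m * (T + s) - pi / 4) / sin (m * T)"
    unfolding defs by (subst if_not_P, force, subst if_not_P, force, subst if_P) auto
  show "t < - \<bar>s\<bar> \<Longrightarrow> green T m t s = cos (m * (t + T) + pi / 4) * cos (m * s - pi / 4) / sin (m * T)"
    unfolding defs by (subst if_not_P, force, subst if_not_P, force, subst if_not_P, force, subst if_P) auto
qed

lemma green_le_green_max:
  assumes "0 < sin (m * T)" "t \<in> {-T..T}" "s \<in> {-T..T}" "t \<noteq> s"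
  shows "green T m t s \<le> green_max T m"
  unfolding green_max_def
proof (rule cSup_upper)
  \<comment> \<open>The \<open>undefined\<close> branch of \<open>green\<close> is reached only on
    the diagonal; taking the maximum with it gives one bound for all arguments without a case
    distinction.\<close>
  have cc: "cos u * cos v \<le> max 1 undefined" for u v :: real
  proof -
    have "cos u * cos v \<le> \<bar>cos u\<bar> * \<bar>cos v\<bar>" by (metis abs_ge_self abs_mult)
    also have "\<dots> \<le> 1" by (intro mult_le_one) auto
    finally show ?thesis by simp
  qed
  have "green T m t s \<le> max 1 undefined / sin (m * T)" for t s
    unfolding green_def Let_def
    by (intro divide_right_mono less_imp_le[OF assms(1)]) (simp add: cc)
  then show "bdd_above {green T m t s |t s. t \<in> {-T..T} \<and> s \<in> {-T..T} \<and> t \<noteq> s}"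
    by (auto simp: bdd_above_def)
qed (use assms in blast)

text \<open>For \<open>0 < t < T\<close> the rotation identity on \<open>{0..t}\<close> and on
  \<open>{t..T}\<close> yields two linear equations for \<open>x t\<close> and
  \<open>x (- t)\<close>. Solving them represents both values as integrals of \<open>h s\<close> and
  \<open>h (- s)\<close> against values of Green's function. These are nonnegative, so the one-sided
  bound \<open>green_max\<close> suffices.\<close>

lemma reflection_periodic_bound:
  fixes x h :: "real \<Rightarrow> real"
  assumes "0 < T" and \<alpha>: "0 < m * T" "m * T < pi / 4"
    and ac: "abs_cont_on (-T) T x" and per: "x (-T) = x T" and N: "negligible N"
    and der: "\<And>t. t \<in> {-T..T} - N \<Longrightarrow> (x has_real_derivative h t - m * x (- t)) (at t)"
    and h: "set_integrable lebesgue {-T..T} h"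
    and t: "t \<in> {-T..T}"
  shows "\<bar>x t\<bar> \<le> green_max T m * L1_norm (-T) T h"
proof -
  let ?k = "\<lambda>s. \<bar>h s\<bar> + \<bar>h (- s)\<bar>" and ?M = "green_max T m" and ?L = "L1_norm (-T) T h"
  have "0 < m" using \<open>0 < T\<close> \<alpha>(1) by (simp add: zero_less_mult_iff)
  have sin_pos: "0 < sin (m * T)" using \<alpha> by (intro sin_gt_zero) auto
  have habs: "set_integrable lebesgue {-T..T} (\<lambda>s. \<bar>h s\<bar>)" using h by (rule set_integrable_abs)
  have int_all: "(\<lambda>s. \<bar>h s\<bar>) integrable_on {-T..T}" and L: "?L = integral {-T..T} (\<lambda>s. \<bar>h s\<bar>)"
    unfolding L1_norm_def using set_lebesgue_integral_eq_integral[OF habs] by auto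
  have int_pos: "(\<lambda>s. \<bar>h s\<bar>) integrable_on {0..T}" and int_neg: "(\<lambda>s. \<bar>h s\<bar>) integrable_on {-T..0}"
    using int_all \<open>0 < T\<close> by (auto intro: integrable_on_subinterval)
  have int_refl: "(\<lambda>s. \<bar>h (- s)\<bar>) integrable_on {0..T}"
    using Henstock_Kurzweil_Integration.integrable_reflect_real[where f = "\<lambda>s. \<bar>h s\<bar>" and a = "-T" and b = 0] int_neg by simp
  have int: "?k integrable_on {0..T}" using int_pos int_refl by (rule integrable_add)
  \<comment> \<open>Folding the negative half of the interval onto \<open>{0..T}\<close> pairs
    \<open>h s\<close> with \<open>h (- s)\<close>, as the rotation identity does.\<close>
  have "?L = integral {-T..0} (\<lambda>s. \<bar>h s\<bar>) + integral {0..T} (\<lambda>s. \<bar>h s\<bar>)"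
    unfolding L using \<open>0 < T\<close> int_all by (intro Henstock_Kurzweil_Integration.integral_combine[symmetric]) auto
  also have "integral {-T..0} (\<lambda>s. \<bar>h s\<bar>) = integral {0..T} (\<lambda>s. \<bar>h (- s)\<bar>)"
    using Henstock_Kurzweil_Integration.integral_reflect_real[where f = "\<lambda>s. \<bar>h s\<bar>" and a = "-T" and b = 0] by simp
  finally have L2: "?L = integral {0..T} ?k"
    using Henstock_Kurzweil_Integration.integral_add[OF int_pos int_refl] by simp
  \<comment> \<open>\<open>C\<close> bounds the numerators of \<open>green\<close>; nonnegativity of
    \<open>w\<close> lets an upper bound control its absolute value.\<close>
  define C where "C = sin (m * T) * ?M"
  have kernel: "\<bar>w\<bar> \<le> C" if "w = sin (m * T) * green T m t s" "0 \<le> w" "t \<in> {-T..T}" "s \<in> {-T..T}" "t \<noteq> s"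
    for w t s
    using green_le_green_max[OF sin_pos that(3-5)] sin_pos that by (simp add: C_def)
  have main: "\<bar>x t\<bar> \<le> ?M * ?L \<and> \<bar>x (- t)\<bar> \<le> ?M * ?L" if t: "t \<in> {0<..<T}" for t
  proof -
    define u v where "u = m * (t - T)" and "v = m * t"
    define A where "A = cos (v - pi / 4) * x t - cos (v + pi / 4) * x (- t)"
    define B where "B = - (cos (u - pi / 4) * x t - cos (u + pi / 4) * x (- t))"
    have "u = m * t - m * T" by (simp add: u_def algebra_simps)
    then have mT: "m * T = v - u" by (simp add: v_def)
    \<comment> \<open>The boundary term at 0 vanishes: both cosines equal
      \<open>cos (pi / 4)\<close> and both values of the solution are \<open>x 0\<close>.\<close>
    have intA: "((\<lambda>s. cos (m * s - pi / 4) * h s + cos (m * s + pi / 4) * h (- s)) has_integral A) {0..t}"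
      using reflection_rotation_integral[OF ac N der, of 0 t 0] t by (simp add: A_def v_def)
    \<comment> \<open>The shift \<open>- (m * T)\<close> brings the phases at \<open>T\<close> back
      to plus and minus \<open>pi / 4\<close>, so the boundary term there is a multiple of
      \<open>x T - x (-T)\<close> and vanishes by periodicity.\<close>
    have intB: "((\<lambda>s. cos (m * (s - T) - pi / 4) * h s + cos (m * (s - T) + pi / 4) * h (- s)) has_integral B) {t..T}"
      using reflection_rotation_integral[OF ac N der, of t T "- (m * T)"] t per
      by (simp add: B_def u_def right_diff_distrib)
    have sub: "?k integrable_on {0..t}" "?k integrable_on {t..T}"
      using int t by (auto intro: integrable_on_subinterval)
    have comb: "integral {0..t} ?k + integral {t..T} ?k = ?L"
      unfolding L2 using t int by (intro Henstock_Kurzweil_Integration.integral_combine) auto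
    have m_mono: "0 \<le> m * r" "m * r \<le> m * T" if "0 \<le> r" "r \<le> T" for r
      using that \<open>0 < m\<close> by (simp_all add: mult_left_mono)
    \<comment> \<open>Here \<open>m * T < pi / 4\<close> enters: it keeps all phases between
      \<open>- pi / 2\<close> and \<open>pi / 2\<close>.\<close>
    have pos1: "0 \<le> cos (m * r - pi / 4)" "0 \<le> cos (m * r + pi / 4)" if "0 \<le> r" "r \<le> T" for r
      using m_mono[OF that] \<alpha> by (auto intro!: cos_ge_zero)
    have pos2: "0 \<le> cos (m * (r - T) - pi / 4)" "0 \<le> cos (m * (r - T) + pi / 4)" if "0 \<le> r" "r \<le> T" for r
      using m_mono[OF that] \<alpha> by (auto intro!: cos_ge_zero simp: right_diff_distrib)
    have neg: "cos (- w - pi / 4) = cos (w + pi / 4)" "cos (- w + pi / 4) = cos (w - pi / 4)"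
        "cos (pi / 4 - w) = cos (w - pi / 4)" for w :: real
      using cos_minus[of "w + pi / 4"] cos_minus[of "w - pi / 4"] by simp_all
    have flip: "m * (T - r) = - (m * (r - T))" "T + - r = T - r" "- t + T = - (t - T)" for r
      by (simp_all add: algebra_simps)
    \<comment> \<open>Cramer's rule for the system defining \<open>A\<close> and \<open>B\<close>,
      with determinant \<open>sin (v - u) = sin (m * T)\<close>.\<close>
    have xt: "sin (m * T) * x t = cos (u + pi / 4) * A + cos (v + pi / 4) * B"
      unfolding mT A_def B_def
      by (simp add: sin_diff cos_add cos_diff cos_45 sin_45) (simp add: field_simps)
    have xmt: "sin (m * T) * x (- t) = cos (u - pi / 4) * A + cos (v - pi / 4) * B"
      unfolding mT A_def B_def
      by (simp add: sin_diff cos_add cos_diff cos_45 sin_45) (simp add: field_simps)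
    note sectors = green_sectors[OF \<open>0 < T\<close>]
    \<comment> \<open>Each kernel is a scaled Green value at one of the points with coordinates plus
      or minus \<open>t\<close> and plus or minus \<open>s\<close>. For \<open>s < t\<close> the
      sign of the first coordinate selects the first or fourth sector; for \<open>t < s\<close> the
      sign of the second selects the second or third.\<close>
    have 1: "\<bar>cos (u + pi / 4) * A\<bar> \<le> C * integral {0..t} ?k"
    proof (rule scaled_integral_bound[OF intA sub(1)])
      fix s assume s: "0 < s" "s < t"
      show "\<bar>cos (u + pi / 4) * cos (m * s - pi / 4)\<bar> \<le> C"
        using s t sin_pos pos1[of s] pos2[of t]
        by (intro kernel[of _ t s]) (auto simp: sectors u_def)
      show "\<bar>cos (u + pi / 4) * cos (m * s + pi / 4)\<bar> \<le> C"
        using s t sin_pos pos1[of s] pos2[of t]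
        by (intro kernel[of _ t "- s"]) (auto simp: sectors u_def neg)
    qed
    have 2: "\<bar>cos (v + pi / 4) * B\<bar> \<le> C * integral {t..T} ?k"
    proof (rule scaled_integral_bound[OF intB sub(2)])
      fix s assume s: "t < s" "s < T"
      show "\<bar>cos (v + pi / 4) * cos (m * (s - T) - pi / 4)\<bar> \<le> C"
        using s t sin_pos pos1[of t] pos2[of s]
        by (intro kernel[of _ t s]) (auto simp: sectors v_def)
      show "\<bar>cos (v + pi / 4) * cos (m * (s - T) + pi / 4)\<bar> \<le> C"
        using s t sin_pos pos1[of t] pos2[of s]
        by (intro kernel[of _ t "- s"]) (auto simp: sectors v_def flip neg)
    qed
    have 3: "\<bar>cos (u - pi / 4) * A\<bar> \<le> C * integral {0..t} ?k"
    proof (rule scaled_integral_bound[OF intA sub(1)])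
      fix s assume s: "0 < s" "s < t"
      show "\<bar>cos (u - pi / 4) * cos (m * s - pi / 4)\<bar> \<le> C"
        using s t sin_pos pos1[of s] pos2[of t]
        by (intro kernel[of _ "- t" s]) (auto simp: sectors u_def flip neg mult_minus_right)
      show "\<bar>cos (u - pi / 4) * cos (m * s + pi / 4)\<bar> \<le> C"
        using s t sin_pos pos1[of s] pos2[of t]
        by (intro kernel[of _ "- t" "- s"]) (auto simp: sectors u_def flip neg mult_minus_right)
    qed
    have 4: "\<bar>cos (v - pi / 4) * B\<bar> \<le> C * integral {t..T} ?k"
    proof (rule scaled_integral_bound[OF intB sub(2)])
      fix s assume s: "t < s" "s < T"
      show "\<bar>cos (v - pi / 4) * cos (m * (s - T) - pi / 4)\<bar> \<le> C"
        using s t sin_pos pos1[of t] pos2[of s]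
        by (intro kernel[of _ "- t" s]) (auto simp: sectors v_def neg)
      show "\<bar>cos (v - pi / 4) * cos (m * (s - T) + pi / 4)\<bar> \<le> C"
        using s t sin_pos pos1[of t] pos2[of s]
        by (intro kernel[of _ "- t" "- s"]) (auto simp: sectors v_def flip neg)
    qed
    have CL: "C * integral {0..t} ?k + C * integral {t..T} ?k = sin (m * T) * (?M * ?L)"
      using comb by (simp add: C_def flip: distrib_left)
    have "\<bar>sin (m * T) * x t\<bar> \<le> sin (m * T) * (?M * ?L)" "\<bar>sin (m * T) * x (- t)\<bar> \<le> sin (m * T) * (?M * ?L)"
      unfolding CL[symmetric] xt xmt using 1 2 3 4 by linarith+
    then show ?thesis
      using sin_pos by (simp add: abs_mult)
  qed
  \<comment> \<open>Continuity carries the bound from \<open>{0<..<T}\<close> to the excluded points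
    0 and \<open>T\<close>.\<close>
  have cont: "continuous_on {-T..T} x" by (rule abs_cont_on_imp_continuous_on[OF ac])
  have cl: "closure {0<..<T} = {0..T}" using \<open>0 < T\<close> by simp
  have "continuous_on {0..T} x" using cont \<open>0 < T\<close> by (auto intro: continuous_on_subset)
  then have c1: "continuous_on {0..T} (\<lambda>s. \<bar>x s\<bar>)" by (intro continuous_intros)
  have "continuous_on {0..T} (\<lambda>s. x (- s))"
    using \<open>0 < T\<close> by (intro continuous_on_compose2[OF cont] continuous_intros) auto
  then have c2: "continuous_on {0..T} (\<lambda>s. \<bar>x (- s)\<bar>)" by (intro continuous_intros)
  have pos: "\<bar>x s\<bar> \<le> ?M * ?L" "\<bar>x (- s)\<bar> \<le> ?M * ?L" if "s \<in> {0..T}" for s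
    using continuous_le_on_closure[of "{0<..<T}" _ s "?M * ?L", unfolded cl] c1 c2 that main by blast+
  show ?thesis
    using pos(1)[of t] pos(2)[of "- t"] t by (cases "0 \<le> t") auto
qed

section \<open>Integration against a signed measure\<close>

lemma signed_measure_Un:
  assumes "signed_measure M \<mu>" "A \<in> sets M" "B \<in> sets M" "A \<inter> B = {}"
  shows "\<mu> (A \<union> B) = \<mu> A + \<mu> B"
proof -
  have "range (binaryset A B) \<subseteq> sets M" "disjoint_family (binaryset A B)"
    using assms by (auto simp: range_binaryset_eq disjoint_family_on_def binaryset_def)
  then have "(\<lambda>i. \<mu> (binaryset A B i)) sums \<mu> (\<Union>i. binaryset A B i)"
    using assms(1) unfolding signed_measure_def by blast
  moreover have "(\<lambda>i. \<mu> (binaryset A B i)) sums (\<mu> A + \<mu> B)"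
    using assms(1) by (intro binaryset_sums) (simp add: signed_measure_def)
  ultimately show ?thesis using sums_unique2 UN_binaryset_eq by metis
qed

lemma signed_measure_diff_le_total_variation:
  assumes \<mu>: "signed_measure M \<mu>" "bounded_variation M \<mu>" and B: "B \<in> sets M" and C: "C \<in> sets M"
  shows "\<mu> B - \<mu> C \<le> total_variation M \<mu> (space M)"
proof -
  have "\<mu> B = \<mu> (B - C) + \<mu> (B \<inter> C)" "\<mu> C = \<mu> (C - B) + \<mu> (B \<inter> C)"
    using signed_measure_Un[OF \<mu>(1), of "B - C" "B \<inter> C"] signed_measure_Un[OF \<mu>(1), of "C - B" "B \<inter> C"] B C
    by (simp_all add: Un_Diff_Int Un_Diff_Int[of C B, unfolded Int_commute[of C]] Diff_Int_distrib disjoint_iff)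
  then have "\<mu> B - \<mu> C \<le> \<bar>\<mu> (B - C)\<bar> + \<bar>\<mu> (C - B)\<bar>" by linarith
  also have "\<dots> \<le> (\<Sum>X\<in>{B - C, C - B, space M - (B - C) - (C - B)}. \<bar>\<mu> X\<bar>)"
  \<comment> \<open>A sum over a set counts equal members once; the two differences coincide only if
    both are empty.\<close>
  proof (cases "B - C = C - B")
    case True
    then have "B - C = {}" "C - B = {}" by auto
    then show ?thesis using \<mu>(1) by (simp add: signed_measure_def sum_nonneg)
  next
    case False
    then have "\<bar>\<mu> (B - C)\<bar> + \<bar>\<mu> (C - B)\<bar> = (\<Sum>X\<in>{B - C, C - B}. \<bar>\<mu> X\<bar>)" by simp
    also have "\<dots> \<le> (\<Sum>X\<in>{B - C, C - B, space M - (B - C) - (C - B)}. \<bar>\<mu> X\<bar>)"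
      by (rule sum_mono2) auto
    finally show ?thesis .
  qed
  also have "\<dots> \<le> total_variation M \<mu> (space M)"
    unfolding total_variation_def
  proof (rule cSup_upper)
    have "B \<subseteq> space M" "C \<subseteq> space M" using B C sets.sets_into_space by auto
    then have "\<Union>{B - C, C - B, space M - (B - C) - (C - B)} = space M" by auto
    moreover have "{B - C, C - B, space M - (B - C) - (C - B)} \<subseteq> sets M" using B C by auto
    moreover have "disjoint {B - C, C - B, space M - (B - C) - (C - B)}"
      by (auto simp: disjoint_def)
    ultimately show "(\<Sum>X\<in>{B - C, C - B, space M - (B - C) - (C - B)}. \<bar>\<mu> X\<bar>) \<in> variation_sums M \<mu> (space M)"
      unfolding variation_sums_def by blast
    show "bdd_above (variation_sums M \<mu> (space M))" using \<mu>(2) by (simp add: bounded_variation_def)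
  qed
  finally show ?thesis .
qed

text \<open>Default values do not spoil the estimate: the mass of the whole space is at most
  \<open>S\<close> in either case of \<open>measure_of\<close>, and a nonintegrable \<open>f\<close>
  has integral 0.\<close>

lemma abs_integral_upper_variation_le:
  fixes f :: "'a \<Rightarrow> real"
  assumes "0 \<le> S" and S: "(SUP B\<in>{B \<in> sets M. B \<subseteq> space M}. \<nu> B) \<le> S"
    and f: "\<And>x. x \<in> space M \<Longrightarrow> \<bar>f x\<bar> \<le> b" and "0 \<le> b"
  shows "\<bar>\<integral>x. f x \<partial>upper_variation M \<nu>\<bar> \<le> b * S"
proof (cases "integrable (upper_variation M \<nu>) f")
  case True
  let ?U = "upper_variation M \<nu>"
  have sp: "space ?U = space M"
    by (simp add: upper_variation_def space_measure_of_conv)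
  have le: "emeasure ?U (space M) \<le> ennreal S"
    using S by (auto simp: upper_variation_def emeasure_measure_of_conv intro: ennreal_leI)
  then interpret finite_measure ?U
    by (intro finite_measureI) (auto simp: sp top_unique)
  have "measure ?U (space M) \<le> S"
    using le \<open>0 \<le> S\<close> by (simp add: emeasure_eq_measure)
  have "\<bar>\<integral>x. f x \<partial>?U\<bar> \<le> (\<integral>x. \<bar>f x\<bar> \<partial>?U)" by (rule integral_abs_bound)
  also have "\<dots> \<le> (\<integral>x. b \<partial>?U)"
    using True f by (intro integral_mono) (auto simp: sp)
  also have "\<dots> = b * measure ?U (space M)" by (simp add: sp)
  also have "\<dots> \<le> b * S" using \<open>measure ?U (space M) \<le> S\<close> \<open>0 \<le> b\<close> by (rule mult_left_mono)
  finally show ?thesis .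
next
  case False
  then show ?thesis using assms by (simp add: not_integrable_integral_eq)
qed

text \<open>No Hahn decomposition is needed: only upper bounds for the two variations of the whole space
  enter, and these hold even before they are known to be measures, because \<open>measure_of\<close> yields the
  zero measure otherwise.\<close>

lemma abs_signed_integral_le:
  fixes f :: "'a \<Rightarrow> real"
  assumes \<mu>: "signed_measure M \<mu>" "bounded_variation M \<mu>"
    and f: "\<And>x. x \<in> space M \<Longrightarrow> \<bar>f x\<bar> \<le> b" and "0 \<le> b"
  shows "\<bar>signed_integral M \<mu> f\<bar> \<le> b * total_variation M \<mu> (space M)"
proof -
  let ?V = "total_variation M \<mu> (space M)" and ?I = "{B \<in> sets M. B \<subseteq> space M}"
  define P Q where "P = (SUP B\<in>?I. \<mu> B)" and "Q = (SUP B\<in>?I. - \<mu> B)"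
  have [simp]: "\<mu> {} = 0" using \<mu>(1) by (simp add: signed_measure_def)
  note diff = signed_measure_diff_le_total_variation[OF \<mu>]
  have ne: "?I \<noteq> {}" by auto
  have bdd: "bdd_above (\<mu> ` ?I)" "bdd_above ((\<lambda>B. - \<mu> B) ` ?I)"
    using diff[of _ "{}"] diff[of "{}"] by (auto intro!: bdd_aboveI2[where M = ?V])
  have "0 \<le> P" "0 \<le> Q"
    unfolding P_def Q_def using cSUP_upper[OF _ bdd(1), of "{}"] cSUP_upper[OF _ bdd(2), of "{}"] by auto
  \<comment> \<open>Taking the suprema over the two sets in \<open>diff\<close> one after the other
    gives \<open>P + Q \<le> ?V\<close>; bounding \<open>P\<close> and \<open>Q\<close> separately
    by \<open>?V\<close> would lose a factor 2.\<close>
  have "P \<le> ?V + \<mu> C" if "C \<in> ?I" for C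
    unfolding P_def using diff[of _ C] that by (intro cSUP_least[OF ne]) (auto simp: algebra_simps)
  then have "Q \<le> ?V - P"
    unfolding Q_def by (intro cSUP_least[OF ne]) (auto simp: algebra_simps)
  have "\<bar>signed_integral M \<mu> f\<bar> \<le> b * P + b * Q"
    unfolding signed_integral_def
    using abs_integral_upper_variation_le[where f = f, OF \<open>0 \<le> P\<close> eq_refl[OF P_def[symmetric]] f \<open>0 \<le> b\<close>]
      abs_integral_upper_variation_le[where f = f, OF \<open>0 \<le> Q\<close> eq_refl[OF Q_def[symmetric]] f \<open>0 \<le> b\<close>]
    by linarith
  also have "\<dots> \<le> b * ?V"
    using \<open>Q \<le> ?V - P\<close> \<open>0 \<le> b\<close> by (simp add: mult_left_mono flip: distrib_left)
  finally show ?thesis .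
qed

section \<open>Positivity\<close>

text \<open>As a shifted cosine, \<open>cos w - sin w\<close> is decreasing for \<open>w\<close>
  between \<open>- \<alpha>\<close> and \<open>\<alpha>\<close>, since \<open>w + pi / 4\<close>
  stays between 0 and \<open>pi / 2\<close>. The upper bound is the value at
  \<open>- \<alpha>\<close>.\<close>

lemma cos_minus_sin_bounds:
  fixes \<alpha> \<theta> :: real
  assumes "\<alpha> < pi / 4" "\<bar>\<theta>\<bar> \<le> \<alpha>"
  shows "cos \<alpha> - sin \<alpha> \<le> cos \<theta> - sin \<theta>" "cos \<theta> - sin \<theta> \<le> cos \<alpha> + sin \<alpha>"
proof -
  have shift: "cos w - sin w = sqrt 2 * cos (w + pi / 4)" for w :: real
    by (simp add: cos_add cos_45 sin_45 algebra_simps)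
  have "cos (\<alpha> + pi / 4) \<le> cos (\<theta> + pi / 4)" "cos (\<theta> + pi / 4) \<le> cos (- \<alpha> + pi / 4)"
    using assms by (auto intro!: cos_monotone_0_pi_le)
  then show "cos \<alpha> - sin \<alpha> \<le> cos \<theta> - sin \<theta>" "cos \<theta> - sin \<theta> \<le> cos \<alpha> + sin \<alpha>"
    unfolding shift shift[of "- \<alpha>", unfolded cos_minus sin_minus diff_minus_eq_add]
    by simp_all
qed

theorem proposition2p3:
  fixes T m c \<alpha> :: real
    and h u :: "real \<Rightarrow> real"
    and F :: "(real \<Rightarrow> real) \<Rightarrow> real"
    and \<mu> :: "real set \<Rightarrow> real"
  assumes "T > 0"
    and "\<alpha> = m * T"
    and "set_integrable lebesgue {-T..T} h"
    and "0 < \<alpha>" and "\<alpha> < pi / 4"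
    and "F \<in> dual_space (W11 (-T) T) (W11_norm (-T) T)
           \<inter> dual_space (cont_fun (-T) T) (sup_norm (-T) T)"
    and "riesz_measure (-T) T F \<mu>"
    and "F (\<lambda>t. cos (m * t)) > F (\<lambda>t. sin (m * t))"
    and "c > 2 * green_max T m * total_variation (borel_on (-T) T) \<mu> {-T..T} * L1_norm (-T) T h
               / (1 - tan \<alpha>)"
    and "is_solution T m h F c u"
  shows "\<forall>t\<in>{-T..T}. u t > 0"
proof -
  define V where "V = total_variation (borel_on (-T) T) \<mu> {-T..T}"
  define R where "R = green_max T m * L1_norm (-T) T h"
  define w where "w t = cos (m * t) - sin (m * t)" for t
  \<comment> \<open>Chosen to make \<open>H (-T) = H T\<close>, since
    \<open>w (-T) - w T = 2 * sin \<alpha>\<close>.\<close>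
  define k where "k = (u (-T) - u T) / (2 * sin \<alpha>)"
  define H where "H t = u t - k * w t" for t
  have "m > 0" using assms(1,2,4) by (simp add: zero_less_mult_iff)
  have sin_pos: "0 < sin \<alpha>" using assms(4,5) by (intro sin_gt_zero) auto
  have cos_pos: "0 < cos \<alpha>" using assms(4,5) by (intro cos_gt_zero) auto
  have tan_lt: "tan \<alpha> < 1"
    using tan_monotone[of \<alpha> "pi / 4"] assms(4,5) by (simp add: tan_45)

  define solves where
    "solves t \<longleftrightarrow> (\<exists>u'. (u has_real_derivative u') (at t) \<and> u' + m * u (- t) = h t)" for t
  have u_ac: "abs_cont_on (-T) T u" and Fu: "F u = c"
    and ode: "AE t in lebesgue. t \<in> {-T..T} \<longrightarrow> solves t"
    using assms(10) by (auto simp: is_solution_def W11_def solves_def)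
  obtain N where "N \<in> null_sets lebesgue"
    and N_sub: "{t \<in> space lebesgue. \<not> (t \<in> {-T..T} \<longrightarrow> solves t)} \<subseteq> N"
    using ode[unfolded eventually_ae_filter] by (elim bexE)
  then have "negligible N" by (simp add: negligible_iff_null_sets)
  have N: "solves t" if "t \<in> {-T..T} - N" for t
    using that N_sub by auto
  have w_eq: "w t = cos (m * t + 0) + cos (m * t + pi / 2)" for t
    by (simp add: w_def cos_add)
  have "abs_cont_on (-T) T (\<lambda>t. u t + - k * w t)"
    unfolding w_eq by (intro abs_cont_on_add abs_cont_on_mult abs_cont_on_const abs_cont_on_cos u_ac)
  then have H_ac: "abs_cont_on (-T) T H" by (simp add: H_def[abs_def])
  have "k * (2 * sin \<alpha>) = u (-T) - u T" using sin_pos by (simp add: k_def)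
  then have H_per: "H (-T) = H T"
    by (simp add: H_def w_def assms(2) algebra_simps)
  have H_der: "(H has_real_derivative h t - m * H (- t)) (at t)" if t: "t \<in> {-T..T} - N" for t
  proof -
    obtain u' where u': "(u has_real_derivative u') (at t)" "u' + m * u (- t) = h t"
      using N[OF t] unfolding solves_def by blast
    \<comment> \<open>The derivative equals \<open>- m * w (- t)\<close>: \<open>w\<close> solves
      the homogeneous equation, so \<open>H\<close> keeps the right-hand side
      \<open>h\<close>.\<close>
    have "(w has_real_derivative - m * sin (m * t) - m * cos (m * t)) (at t)"
      unfolding w_def by (auto intro!: derivative_eq_intros)
    from DERIV_diff[OF u'(1) DERIV_cmult[OF this, of k]]
    show ?thesis
      unfolding H_def[abs_def] by (rule DERIV_cong) (simp add: w_def u'(2)[symmetric] algebra_simps)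
  qed
  have H_le: "\<bar>H t\<bar> \<le> R" if "t \<in> {-T..T}" for t
    unfolding R_def using reflection_periodic_bound[OF assms(1) _ _ H_ac H_per \<open>negligible N\<close> H_der assms(3) that]
      assms(2,4,5) by simp
  have "0 \<le> R" using H_le[of 0] assms(1) by auto

  have in_cont: "(\<lambda>t. cos (m * t)) \<in> cont_fun (-T) T" "(\<lambda>t. sin (m * t)) \<in> cont_fun (-T) T"
      "w \<in> cont_fun (-T) T" "H \<in> cont_fun (-T) T"
    using abs_cont_on_imp_continuous_on[OF H_ac]
    by (auto simp: cont_fun_def w_def[abs_def] intro!: continuous_intros)
  have F_add: "F (\<lambda>t. f t + g t) = F f + F g" if "f \<in> cont_fun (-T) T" "g \<in> cont_fun (-T) T" for f g
    using assms(6) that by (auto simp: dual_space_def)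
  have F_cmult: "F (\<lambda>t. r * f t) = r * F f" if "f \<in> cont_fun (-T) T" for f r
    using assms(6) that by (auto simp: dual_space_def)
  have cmult_cont: "(\<lambda>t. r * f t) \<in> cont_fun (-T) T" if "f \<in> cont_fun (-T) T" for f r
    using that by (auto simp: cont_fun_def intro: continuous_intros)
  have F_le: "\<bar>F f\<bar> \<le> b * V" if "f \<in> cont_fun (-T) T" "\<And>t. t \<in> {-T..T} \<Longrightarrow> \<bar>f t\<bar> \<le> b" "0 \<le> b" for f b
    using abs_signed_integral_le[of "borel_on (-T) T" \<mu> f b] assms(7) that
    by (simp add: riesz_measure_def V_def space_restrict_space)
  have "F w = F (\<lambda>t. cos (m * t)) - F (\<lambda>t. sin (m * t))"
    using F_add[OF in_cont(1) cmult_cont[OF in_cont(2), of "-1"]] F_cmult[OF in_cont(2), of "-1"]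
    by (simp add: w_def[abs_def])
  then have Fw_pos: "0 < F w" using assms(8) by simp
  have c_eq: "c = k * F w + F H"
    using F_add[OF cmult_cont[OF in_cont(3), of k] in_cont(4)] F_cmult[OF in_cont(3), of k] Fu
    by (simp add: H_def)

  have w_lo: "cos \<alpha> - sin \<alpha> \<le> w t" and w_hi: "w t \<le> cos \<alpha> + sin \<alpha>" if "t \<in> {-T..T}" for t
  proof -
    have "\<bar>m * t\<bar> \<le> \<alpha>" using that \<open>m > 0\<close> assms(2) by (auto simp: abs_mult)
    from cos_minus_sin_bounds[OF assms(5) this]
    show "cos \<alpha> - sin \<alpha> \<le> w t" "w t \<le> cos \<alpha> + sin \<alpha>" by (simp_all add: w_def)
  qed
  have diff_pos: "0 < cos \<alpha> - sin \<alpha>"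
    using tan_lt cos_pos by (simp add: tan_def)
  have "\<bar>F w\<bar> \<le> (cos \<alpha> + sin \<alpha>) * V"
    using w_lo w_hi diff_pos sin_pos cos_pos by (intro F_le in_cont) fastforce+
  then have Fw_le: "F w \<le> (cos \<alpha> + sin \<alpha>) * V" using Fw_pos by simp
  \<comment> \<open>Positivity of \<open>F w\<close> forces the total variation of
    \<open>\<mu>\<close> to be positive, which later permits cancelling \<open>V\<close>.\<close>
  with Fw_pos have "0 < (cos \<alpha> + sin \<alpha>) * V" by simp
  then have V_pos: "0 < V" using sin_pos cos_pos by (simp add: zero_less_mult_iff)
  have FH: "\<bar>F H\<bar> \<le> R * V" by (rule F_le[OF in_cont(4) H_le \<open>0 \<le> R\<close>])

  \<comment> \<open>The denominator \<open>1 - tan \<alpha>\<close> is positive and can be cleared;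
    multiplying by \<open>cos \<alpha>\<close> then removes the tangent.\<close>
  have "2 * (R * V) < c * (1 - tan \<alpha>)"
    using assms(9) tan_lt by (simp add: R_def V_def field_simps)
  then have "2 * (R * V) * cos \<alpha> < c * (1 - tan \<alpha>) * cos \<alpha>"
    using cos_pos by simp
  moreover have "(1 - tan \<alpha>) * cos \<alpha> = cos \<alpha> - sin \<alpha>"
    using cos_pos by (simp add: tan_def field_simps)
  ultimately have c_gt: "2 * (R * V) * cos \<alpha> < c * (cos \<alpha> - sin \<alpha>)"
    by (simp add: mult.assoc)
  \<comment> \<open>\<open>2 * cos \<alpha>\<close> splits into
    \<open>cos \<alpha> + sin \<alpha>\<close> and \<open>cos \<alpha> - sin \<alpha>\<close>; the
    second part moves to the right.\<close>
  have "R * V * (cos \<alpha> + sin \<alpha>) < (c - R * V) * (cos \<alpha> - sin \<alpha>)"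
    using c_gt by (simp add: algebra_simps)
  also have "\<dots> \<le> k * F w * (cos \<alpha> - sin \<alpha>)"
    using FH c_eq diff_pos by (intro mult_right_mono) auto
  finally have k_gt: "R * V * (cos \<alpha> + sin \<alpha>) < k * (cos \<alpha> - sin \<alpha>) * F w"
    by (simp add: mult_ac)
  have "0 \<le> R * V * (cos \<alpha> + sin \<alpha>)"
    using \<open>0 \<le> R\<close> V_pos sin_pos cos_pos by simp
  with k_gt have "0 < k * (cos \<alpha> - sin \<alpha>) * F w" by linarith
  then have k_pos: "0 < k" using Fw_pos diff_pos by (simp add: zero_less_mult_iff)
  \<comment> \<open>With \<open>k\<close> known to be positive, \<open>F w\<close> may be replaced
    by its upper bound, whose factor then cancels on both sides.\<close>
  have "k * (cos \<alpha> - sin \<alpha>) * F w \<le> k * (cos \<alpha> - sin \<alpha>) * ((cos \<alpha> + sin \<alpha>) * V)"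
    using Fw_le k_pos diff_pos by (intro mult_left_mono) auto
  with k_gt have "R * ((cos \<alpha> + sin \<alpha>) * V) < k * (cos \<alpha> - sin \<alpha>) * ((cos \<alpha> + sin \<alpha>) * V)"
    by (simp add: mult_ac)
  then have R_lt: "R < k * (cos \<alpha> - sin \<alpha>)"
    using \<open>0 < (cos \<alpha> + sin \<alpha>) * V\<close> by (metis mult_less_cancel_right_pos)
  show ?thesis
  proof
    fix t assume t: "t \<in> {-T..T}"
    \<comment> \<open>In \<open>u t = k * w t + H t\<close> the first summand exceeds
      \<open>R\<close>, which bounds the absolute value of the second.\<close>
    have "k * (cos \<alpha> - sin \<alpha>) \<le> k * w t" using w_lo[OF t] k_pos by simp
    with R_lt H_le[OF t] show "u t > 0" by (simp add: H_def abs_le_iff)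
  qed
qed

end
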